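(* Let $H$ be a real or complex Hilbert space. The following statements are true: (1) If $A:H\to H$ is a continuous linear operator and scalars $\lambda_1,\dots,\lambda_n$ are pairwise distinct, then the system of eigenspaces $H_k:=\ker(A-\lambda_kI)$, $k=1,\dots,n$, possesses the IBAP. (2) If a system of closed subspaces $H_1,\dots,H_n$ of $H$ possesses the IBAP and scalars $\lambda_1,\dots,\lambda_n$ are pairwise distinct, then there exists a continuous linear operator $A:H\to H$ such that $H_k=\ker(A-\lambda_kI)$, $k=1,\dots,n$.
   Context: A system of closed subspaces $H_1,\dots,H_n$ of $H$, with $P_k$ the orthogonal projection onto $H_k$, possesses the inverse best approximation property (IBAP) if for arbitrary $x_1\in H_1,\dots,x_n\in H_n$ there exists $x\in H$ such that $P_kx=x_k$ for all $k=1,\dots,n$. $I$ is the identity operator; scalars are elements of the base field of $H$. *)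

theory Defs
  imports "HOL-Analysis.Analysis"
begin

class complex_vector = real_vector +
  fixes scaleC :: "complex \<Rightarrow> 'a \<Rightarrow> 'a"  (infixr \<open>*\<^sub>C\<close> 75)
  assumes scaleC_add_right: "c *\<^sub>C (x + y) = c *\<^sub>C x + c *\<^sub>C y"
    and scaleC_add_left: "(c + d) *\<^sub>C x = c *\<^sub>C x + d *\<^sub>C x"
    and scaleC_scaleC: "c *\<^sub>C (d *\<^sub>C x) = (c * d) *\<^sub>C x"
    and scaleC_one: "1 *\<^sub>C x = x"
    and scaleR_scaleC: "r *\<^sub>R x = complex_of_real r *\<^sub>C x"

global_interpretation complex_vector:
  vector_space "scaleC :: complex \<Rightarrow> 'a \<Rightarrow> 'a::complex_vector"
  by unfold_locales
    (simp_all add: scaleC_add_right scaleC_add_left scaleC_scaleC scaleC_one)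

abbreviation clinear :: "('a::complex_vector \<Rightarrow> 'b::complex_vector) \<Rightarrow> bool"
  where "clinear \<equiv> Vector_Spaces.linear scaleC scaleC"

text \<open>
  The inner product is conjugate-linear in its first argument. Its real part is required to be the
  underlying real inner product; positive definiteness and the identity
  \<open>norm x = sqrt (Re (cinner x x))\<close> are therefore inherited from \<^class>\<open>real_inner\<close>. This loses no
  generality, because the real part of a complex inner product is always a real inner product with
  the same norm. A complex Hilbert space is a type of sort \<open>{complex_inner, complete_space}\<close>, a real
  one a type of sort \<open>{real_inner, complete_space}\<close>.
\<close>

class complex_inner = complex_vector + real_inner +
  fixes cinner :: "'a \<Rightarrow> 'a \<Rightarrow> complex"
  assumes cinner_commute: "cinner x y = cnj (cinner y x)"
    and cinner_add_right: "cinner x (y + z) = cinner x y + cinner x z"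
    and cinner_scaleC_right: "cinner x (c *\<^sub>C y) = c * cinner x y"
    and Re_cinner: "Re (cinner x y) = inner x y"

lemma cinner_self: "cinner x x = complex_of_real ((norm x)\<^sup>2)"
  for x :: "'a::complex_inner"
proof -
  have "Im (cinner x x) = 0"
    using arg_cong[OF cinner_commute[of x x], of Im] by simp
  then show ?thesis
    by (simp add: complex_eq_iff Re_cinner dot_square_norm)
qed

instantiation complex :: complex_inner
begin

definition scaleC_complex :: "complex \<Rightarrow> complex \<Rightarrow> complex"
  where "scaleC_complex c x = c * x"

definition cinner_complex :: "complex \<Rightarrow> complex \<Rightarrow> complex"
  where "cinner_complex x y = cnj x * y"

instance
  by standard
    (simp_all add: scaleC_complex_def cinner_complex_def inner_complex_def algebra_simps
      scaleR_conv_of_real)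

end

text \<open>
  Both projections are total functions via a definite description; the described point exists and is
  unique whenever \<open>S\<close> is a closed subspace of a Hilbert space.
\<close>

definition orth_proj :: "'a::real_inner set \<Rightarrow> 'a \<Rightarrow> 'a"
  where "orth_proj S x = (THE p. p \<in> S \<and> (\<forall>y\<in>S. orthogonal (x - p) y))"

definition corth_proj :: "'a::complex_inner set \<Rightarrow> 'a \<Rightarrow> 'a"
  where "corth_proj S x = (THE p. p \<in> S \<and> (\<forall>y\<in>S. cinner (x - p) y = 0))"

text \<open>
  Having the inverse best approximation property includes being a system of closed subspaces.
\<close>

definition ibap :: "nat \<Rightarrow> (nat \<Rightarrow> 'a::real_inner set) \<Rightarrow> bool"
  where "ibap n H \<longleftrightarrow>
    (\<forall>k\<in>{1..n}. subspace (H k) \<and> closed (H k)) \<and>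
    (\<forall>x. (\<forall>k\<in>{1..n}. x k \<in> H k) \<longrightarrow> (\<exists>z. \<forall>k\<in>{1..n}. orth_proj (H k) z = x k))"

definition cibap :: "nat \<Rightarrow> (nat \<Rightarrow> 'a::complex_inner set) \<Rightarrow> bool"
  where "cibap n H \<longleftrightarrow>
    (\<forall>k\<in>{1..n}. complex_vector.subspace (H k) \<and> closed (H k)) \<and>
    (\<forall>x. (\<forall>k\<in>{1..n}. x k \<in> H k) \<longrightarrow> (\<exists>z. \<forall>k\<in>{1..n}. corth_proj (H k) z = x k))"

end

theory Submission
  imports Defs
begin

text \<open>
  For part (1), Lagrange interpolation turns pairwise distinct scalars into bounded operators
  \<open>Q k = (\<Prod>j \<noteq> k. (A - l j I) / (l k - l j))\<close>, which are the identity on the \<open>k\<close>-th eigenspace and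
  vanish on the others. Given \<open>x k\<close> in the eigenspaces, the vector \<open>z\<close> that represents the bounded
  functional \<open>y \<mapsto> (\<Sum>k. \<langle>x k, Q k y\<rangle>)\<close> satisfies \<open>\<langle>z, y\<rangle> = \<langle>x j, y\<rangle>\<close> for all \<open>y\<close> in the \<open>j\<close>-th
  eigenspace. This says exactly that the projection of \<open>z\<close> to that eigenspace is \<open>x j\<close>.

  For part (2), the idea is to let \<open>A\<close> act as \<open>l k\<close> on \<open>H k\<close> and as a scalar \<open>m\<close> different from all
  \<open>l k\<close> on the orthogonal complement of the sum. The question is whether this is well defined and
  bounded. If \<open>z\<close> has projection \<open>P x\<close> to \<open>H k\<close> and \<open>0\<close> to the other \<open>H j\<close>, then
  \<open>\<langle>x, y k\<rangle> = \<langle>z, \<Sum>j. y j\<rangle>\<close> for all \<open>y j \<in> H j\<close>. Thus the components \<open>y k\<close> of the sums in the unit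
  ball are weakly bounded, hence bounded, by the uniform boundedness principle
  (\<open>ibap_component_bound\<close>). So components are unique and depend continuously on the sum, the sum of
  the \<open>H k\<close> is closed (\<open>ibap_closed_sum\<close>), and each vector splits into components in the \<open>H k\<close> and
  a remainder orthogonal to all of them, by bounded operators (\<open>ibap_component_operators\<close>).

  A complex Hilbert space is treated as a real one on which more scalars act: a complex subspace has
  the same orthogonal projection for \<open>Re \<langle>x, y\<rangle>\<close> as for \<open>\<langle>x, y\<rangle>\<close>. The analysis is therefore done for
  real inner products only, and the scalar field is a parameter of the locale \<open>hilbert_scaling\<close>.
\<close>

section \<open>Orthogonal projection and the Riesz representation theorem\<close>

lemma orth_proj_eqI:
  assumes S: "subspace S" and p: "p \<in> S" and ort: "\<And>y. y \<in> S \<Longrightarrow> orthogonal (x - p) y"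
  shows "orth_proj S x = p"
  unfolding orth_proj_def
proof (rule the_equality)
  show "p \<in> S \<and> (\<forall>y\<in>S. orthogonal (x - p) y)"
    using p ort by blast
next
  fix q assume q: "q \<in> S \<and> (\<forall>y\<in>S. orthogonal (x - q) y)"
  then have "q - p \<in> S"
    using S p by (simp add: subspace_diff)
  then have "inner (x - p) (q - p) = 0" "inner (x - q) (q - p) = 0"
    using q ort by (auto simp: orthogonal_def)
  then have "inner (q - p) (q - p) = 0"
    by (simp add: inner_diff_left)
  then show "q = p"
    by simp
qed

text \<open>
  The projection is the nearest point of \<open>S\<close>. A minimizing sequence is Cauchy by the parallelogram
  law, since midpoints of its members lie in \<open>S\<close> and so are no closer to \<open>x\<close> than the infimum.
\<close>

lemma closed_subspace_orthogonal_projection: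
  fixes S :: "'a::{real_inner, complete_space} set"
  assumes S: "subspace S" and cl: "closed S"
  shows "\<exists>p\<in>S. \<forall>y\<in>S. orthogonal (x - p) y"
proof -
  define D where "D = (INF y\<in>S. (norm (x - y))\<^sup>2)"
  have bdd: "bdd_below ((\<lambda>y. (norm (x - y))\<^sup>2) ` S)"
    by (rule bdd_belowI[of _ 0]) auto
  have D_le: "D \<le> (norm (x - y))\<^sup>2" if "y \<in> S" for y
    unfolding D_def by (rule cINF_lower[OF bdd that])
  have "\<exists>y\<in>S. (norm (x - y))\<^sup>2 < D + inverse (real (Suc m))" for m
  proof (rule ccontr)
    assume "\<not> ?thesis"
    then have "D + inverse (real (Suc m)) \<le> D"
      unfolding D_def using subspace_0[OF S] by (intro cINF_greatest) (auto simp: not_less)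
    then show False
      using inverse_positive_iff_positive[of "real (Suc m)"] by linarith
  qed
  then obtain Y where YS: "\<And>m. Y m \<in> S"
    and Y: "\<And>m. (norm (x - Y m))\<^sup>2 < D + inverse (real (Suc m))"
    by metis
  have est: "(norm (Y m - Y k))\<^sup>2 \<le> 2 * inverse (real (Suc m)) + 2 * inverse (real (Suc k))" for m k
  proof -
    have "(1/2) *\<^sub>R (Y m + Y k) \<in> S"
      using S YS by (simp add: subspace_add subspace_scale)
    then have "D \<le> (norm (x - (1/2) *\<^sub>R (Y m + Y k)))\<^sup>2"
      by (rule D_le)
    moreover have "(norm (Y m - Y k))\<^sup>2 + 4 * (norm (x - (1/2) *\<^sub>R (Y m + Y k)))\<^sup>2
        = 2 * (norm (x - Y m))\<^sup>2 + 2 * (norm (x - Y k))\<^sup>2"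
      by (simp add: power2_norm_eq_inner inner_simps inner_commute algebra_simps)
    ultimately show ?thesis
      using Y[of m] Y[of k] by linarith
  qed
  have "Cauchy Y"
    unfolding Cauchy_iff
  proof (intro allI impI)
    fix e :: real assume "e > 0"
    then obtain M where M: "inverse (real (Suc M)) < e\<^sup>2 / 4"
      using reals_Archimedean[of "e\<^sup>2 / 4"] by auto
    have "norm (Y m - Y k) < e" if "m \<ge> M" "k \<ge> M" for m k
    proof -
      have "inverse (real (Suc m)) \<le> inverse (real (Suc M))"
        "inverse (real (Suc k)) \<le> inverse (real (Suc M))"
        using that by (auto intro!: le_imp_inverse_le)
      then have "(norm (Y m - Y k))\<^sup>2 < e\<^sup>2"
        using est[of m k] M by linarith
      then show ?thesis
        using \<open>e > 0\<close> by (simp add: power2_less_imp_less)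
    qed
    then show "\<exists>M. \<forall>m\<ge>M. \<forall>k\<ge>M. norm (Y m - Y k) < e"
      by blast
  qed
  then obtain p where p: "Y \<longlonglongrightarrow> p"
    using Cauchy_convergent_iff convergent_def by blast
  have pS: "p \<in> S"
    using cl p YS closed_sequentially by blast
  have "(\<lambda>m. (norm (x - Y m))\<^sup>2) \<longlonglongrightarrow> (norm (x - p))\<^sup>2"
    by (intro tendsto_intros p)
  moreover have "(\<lambda>m. D + inverse (real (Suc m))) \<longlonglongrightarrow> D + 0"
    by (intro tendsto_intros LIMSEQ_inverse_real_of_nat)
  ultimately have "(norm (x - p))\<^sup>2 \<le> D + 0"
    by (rule LIMSEQ_le) (use Y less_imp_le in blast)
  then have min: "(norm (x - p))\<^sup>2 \<le> (norm (x - y))\<^sup>2" if "y \<in> S" for y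
    using D_le[OF that] by linarith
  have "inner (x - p) y = 0" if y: "y \<in> S" for y
  proof (cases "y = 0")
    case False
    \<comment> \<open>This \<open>t\<close> minimizes the distance from \<open>x\<close> to the points \<open>p + t y\<close>.\<close>
    define t where "t = inner (x - p) y / inner y y"
    have yy: "inner y y > 0"
      using False by simp
    have "(norm (x - p))\<^sup>2 \<le> (norm (x - (p + t *\<^sub>R y)))\<^sup>2"
      using S pS y by (intro min) (simp add: subspace_add subspace_scale)
    also have "\<dots> = (norm (x - p))\<^sup>2 - 2 * t * inner (x - p) y + t\<^sup>2 * inner y y"
      unfolding power2_norm_eq_inner
      by (simp add: inner_simps inner_commute algebra_simps power2_eq_square)
    also have "\<dots> = (norm (x - p))\<^sup>2 - (inner (x - p) y)\<^sup>2 / inner y y"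
      using yy by (simp add: t_def power2_eq_square field_simps)
    finally have "(inner (x - p) y)\<^sup>2 \<le> 0"
      using yy by (simp add: divide_le_0_iff)
    then show ?thesis
      by simp
  qed simp
  then show ?thesis
    using pS by (auto simp: orthogonal_def)
qed

lemma
  fixes S :: "'a::{real_inner, complete_space} set"
  assumes "subspace S" and "closed S"
  shows orth_proj_in: "orth_proj S x \<in> S"
    and orth_proj_orthogonal: "y \<in> S \<Longrightarrow> orthogonal (x - orth_proj S x) y"
  using closed_subspace_orthogonal_projection[OF assms, of x] orth_proj_eqI[OF assms(1)]
  by metis+

text \<open>
  If \<open>f \<noteq> 0\<close>, the orthogonal complement of its kernel is the line spanned by a vector \<open>w\<close>, and the
  representing vector is a multiple of \<open>w\<close>.
\<close>

lemma riesz_representation: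
  fixes f :: "'a::{real_inner, complete_space} \<Rightarrow> real"
  assumes "bounded_linear f"
  shows "\<exists>z. \<forall>y. f y = inner z y"
proof (cases "\<forall>y. f y = 0")
  case True
  then show ?thesis
    by (intro exI[of _ 0]) simp
next
  case False
  interpret f: bounded_linear f by fact
  obtain x where x: "f x \<noteq> 0"
    using False by blast
  define N where "N = {y. f y = 0}"
  have N: "subspace N"
    by (auto simp: N_def subspace_def f.add f.scaleR f.zero)
  have cl: "closed N"
    unfolding N_def by (intro closed_Collect_eq continuous_on_const f.continuous_on continuous_on_id)
  define w where "w = x - orth_proj N x"
  have w: "f w = f x" "\<And>y. y \<in> N \<Longrightarrow> inner w y = 0"
    using orth_proj_in[OF N cl, of x] orth_proj_orthogonal[OF N cl, of _ x]
    by (auto simp: w_def N_def f.diff orthogonal_def)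
  have ww: "inner w w \<noteq> 0"
    using w(1) x f.zero by auto
  show ?thesis
  proof (intro exI allI)
    fix y
    have "f w *\<^sub>R y - f y *\<^sub>R w \<in> N"
      by (simp add: N_def f.diff f.scaleR)
    then have "inner w (f w *\<^sub>R y - f y *\<^sub>R w) = 0"
      by (rule w)
    then show "f y = inner ((f w / inner w w) *\<^sub>R w) y"
      using ww by (simp add: inner_diff_right field_simps)
  qed
qed

section \<open>Uniform boundedness\<close>

text \<open>
  The sets on which all \<open>f i\<close> are bounded by a given \<open>N\<close> are closed and cover the space, so by
  Baire one of them contains a ball; differences of points of the ball give all small vectors.
\<close>

lemma uniform_boundedness_principle:
  fixes f :: "'i \<Rightarrow> 'a::{real_normed_vector, complete_space} \<Rightarrow> 'b::real_normed_vector"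
  assumes lin: "\<And>i. i \<in> I \<Longrightarrow> bounded_linear (f i)"
    and bdd: "\<And>x. \<exists>M. \<forall>i\<in>I. norm (f i x) \<le> M"
  shows "\<exists>C. \<forall>i\<in>I. \<forall>x. norm (f i x) \<le> C * norm x"
proof -
  define F where "F N = {x. \<forall>i\<in>I. norm (f i x) \<le> real N}" for N
  have cl: "closed (F N)" for N
  proof -
    have "F N = (\<Inter>i\<in>I. {x. norm (f i x) \<le> real N})"
      by (auto simp: F_def)
    moreover have "closed {x. norm (f i x) \<le> real N}" if "i \<in> I" for i
      by (intro closed_Collect_le continuous_on_norm continuous_on_const
          bounded_linear.continuous_on[OF lin[OF that]] continuous_on_id)
    ultimately show ?thesis
      by auto
  qed
  have "x \<in> \<Union>(range F)" for x
  proof -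
    obtain M where M: "\<forall>i\<in>I. norm (f i x) \<le> M"
      using bdd by blast
    obtain N where "M \<le> real N"
      using real_arch_simple by blast
    then have "x \<in> F N"
      using M by (force simp: F_def)
    then show ?thesis
      by blast
  qed
  then have cover: "\<Union>(range F) = UNIV"
    by blast
  have "\<exists>N. interior (F N) \<noteq> {}"
  proof (rule ccontr)
    assume "\<not> ?thesis"
    then have "euclidean interior_of \<Union>(range F) = {}"
      using cl by (intro Baire_category_alt disjI1 completely_metrizable_space_euclidean) auto
    then show False
      by (simp add: cover)
  qed
  then obtain N x0 r where r: "r > 0" and ball: "cball x0 r \<subseteq> F N"
    using mem_interior_cball by (metis all_not_in_conv)
  have "norm (f i x) \<le> (2 * real N / r) * norm x" if i: "i \<in> I" for i x
  proof (cases "x = 0")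
    case True
    then show ?thesis
      using linear_0[OF bounded_linear.linear[OF lin[OF i]]] by simp
  next
    case False
    interpret f: bounded_linear "f i"
      by (rule lin[OF i])
    define u where "u = (r / norm x) *\<^sub>R x"
    have "norm u = r"
      using False r by (simp add: u_def)
    then have "x0 + u \<in> F N" "x0 \<in> F N"
      using ball r by (auto simp: dist_norm subset_iff)
    then have "norm (f i (x0 + u)) \<le> real N" "norm (f i x0) \<le> real N"
      using i by (auto simp: F_def)
    moreover have "f i u = f i (x0 + u) - f i x0"
      by (simp add: f.add)
    ultimately have "norm (f i u) \<le> 2 * real N"
      using norm_triangle_ineq4[of "f i (x0 + u)" "f i x0"] by simp
    then have "(r / norm x) * norm (f i x) \<le> 2 * real N"
      using r by (simp add: u_def f.scaleR)
    then show ?thesis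
      using False r by (simp add: field_simps)
  qed
  then show ?thesis
    by blast
qed

lemma linear_continuous_imp_bounded_linear:
  fixes f :: "'a::real_normed_vector \<Rightarrow> 'b::real_normed_vector"
  assumes "linear f" and "continuous_on UNIV f"
  shows "bounded_linear f"
proof -
  interpret linear f by fact
  have "isCont f 0"
    using assms(2) by (simp add: continuous_on_eq_continuous_at)
  then obtain d where d: "d > 0" "\<And>x. norm x < d \<Longrightarrow> norm (f x) < 1"
    unfolding continuous_at_eps_delta dist_norm using zero by (metis diff_zero zero_less_one)
  have "norm (f x) \<le> norm x * (2 / d)" for x
  proof (cases "x = 0")
    case False
    have "norm (f ((d / (2 * norm x)) *\<^sub>R x)) < 1"
      using False d(1) by (intro d(2)) simp
    then show ?thesis
      using False d(1) by (simp add: scale field_simps)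
  qed (simp add: zero)
  then show ?thesis
    by (intro bounded_linear_intro[where K = "2 / d"]) (auto simp: add scale)
qed

section \<open>Surjectivity from separating operators\<close>

text \<open>
  If \<open>Q\<^sup>*\<close> denotes the adjoint, the vector \<open>z = (\<Sum>k. (Q k)\<^sup>* (x k))\<close> has the required projections.
  It is obtained directly as the Riesz representative of \<open>y \<mapsto> (\<Sum>k. \<langle>x k, Q k y\<rangle>)\<close>.
\<close>

lemma ibap_if_biorthogonal_operators:
  fixes H :: "nat \<Rightarrow> 'a::{real_inner, complete_space} set"
  assumes H: "\<And>k. k \<in> {1..n} \<Longrightarrow> subspace (H k) \<and> closed (H k)"
    and Q: "\<And>k. k \<in> {1..n} \<Longrightarrow> bounded_linear (Q k)"
    and Q_id: "\<And>k x. k \<in> {1..n} \<Longrightarrow> x \<in> H k \<Longrightarrow> Q k x = x"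
    and Q_0: "\<And>k j x. k \<in> {1..n} \<Longrightarrow> j \<in> {1..n} \<Longrightarrow> j \<noteq> k \<Longrightarrow> x \<in> H j \<Longrightarrow> Q k x = 0"
  shows "ibap n H"
  unfolding ibap_def
proof (intro conjI allI impI)
  show "\<forall>k\<in>{1..n}. subspace (H k) \<and> closed (H k)"
    using H by blast
next
  fix x assume x: "\<forall>k\<in>{1..n}. x k \<in> H k"
  have "bounded_linear (\<lambda>y. \<Sum>k\<in>{1..n}. inner (x k) (Q k y))"
    by (intro bounded_linear_sum bounded_linear_compose[OF bounded_linear_inner_right Q])
  then obtain z where z: "\<And>y. (\<Sum>k\<in>{1..n}. inner (x k) (Q k y)) = inner z y"
    using riesz_representation by blast
  have "orth_proj (H j) z = x j" if j: "j \<in> {1..n}" for j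
  proof (rule orth_proj_eqI)
    fix y assume y: "y \<in> H j"
    have "inner z y = (\<Sum>k\<in>{1..n}. inner (x k) (Q k y))"
      by (rule z[symmetric])
    also have "\<dots> = (\<Sum>k\<in>{1..n}. if k = j then inner (x j) y else 0)"
      using j y by (intro sum.cong) (auto simp: Q_id Q_0)
    also have "\<dots> = inner (x j) y"
      using j by simp
    finally show "orthogonal (z - x j) y"
      by (simp add: orthogonal_def inner_diff_left)
  qed (use H x j in auto)
  then show "\<exists>z. \<forall>k\<in>{1..n}. orth_proj (H k) z = x k"
    by blast
qed

text \<open>
  This is the product in Lagrange interpolation, with \<open>D j\<close> in the role of \<open>(A - l j I) / (l k - l j)\<close>.
  The composite vanishes on \<open>H j\<close> because the factors applied before \<open>D j\<close> leave \<open>H j\<close> invariant.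
\<close>

lemma composite_separating_operator:
  fixes H :: "'i \<Rightarrow> 'a::real_normed_vector set"
  assumes "finite J"
    and "\<And>j. j \<in> J \<Longrightarrow> bounded_linear (D j)"
    and "\<And>j x. j \<in> J \<Longrightarrow> x \<in> H k \<Longrightarrow> D j x = x"
    and "\<And>j x. j \<in> J \<Longrightarrow> x \<in> H j \<Longrightarrow> D j x = 0"
    and "\<And>i j x. i \<in> J \<Longrightarrow> j \<in> J \<Longrightarrow> x \<in> H i \<Longrightarrow> D j x \<in> H i"
  shows "\<exists>Q. bounded_linear Q \<and> (\<forall>x\<in>H k. Q x = x) \<and> (\<forall>j\<in>J. \<forall>x\<in>H j. Q x = 0)"
  using assms
proof (induction J rule: finite_induct)
  case empty
  show ?case
    by (intro exI[of _ "\<lambda>x. x"]) (simp add: bounded_linear_ident)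
next
  case (insert i J)
  then have "\<exists>Q. bounded_linear Q \<and> (\<forall>x\<in>H k. Q x = x) \<and> (\<forall>j\<in>J. \<forall>x\<in>H j. Q x = 0)"
    by (intro insert.IH) auto
  then obtain Q where Q: "bounded_linear Q" "\<forall>x\<in>H k. Q x = x" "\<forall>j\<in>J. \<forall>x\<in>H j. Q x = 0"
    by blast
  interpret Q: bounded_linear Q by fact
  have "bounded_linear (\<lambda>x. Q (D i x))"
    using insert.prems(1)[of i] by (intro bounded_linear_compose[OF Q(1)]) simp
  moreover have "\<forall>x\<in>H k. Q (D i x) = x"
    using Q(2) insert.prems(2) by simp
  moreover have "Q (D i x) = 0" if "j \<in> insert i J" "x \<in> H j" for j x
    using that Q(3) Q.zero insert.prems(3)[of i x] insert.prems(4)[of j i x] by auto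
  ultimately show ?case
    by blast
qed

section \<open>Decomposition along a system with the IBAP\<close>

text \<open>
  This makes \<open>\<Sum>k. y k\<close> the orthogonal projection of \<open>x\<close> to the sum of the subspaces \<open>H k\<close>, since a
  remainder orthogonal to each \<open>H k\<close> is orthogonal to that sum.
\<close>

definition orth_decomp :: "nat \<Rightarrow> (nat \<Rightarrow> 'a::real_inner set) \<Rightarrow> 'a \<Rightarrow> (nat \<Rightarrow> 'a) \<Rightarrow> bool"
  where "orth_decomp n H x y \<longleftrightarrow> (\<forall>k\<in>{1..n}. y k \<in> H k) \<and>
    (\<forall>k\<in>{1..n}. \<forall>v\<in>H k. orthogonal (x - (\<Sum>j\<in>{1..n}. y j)) v)"

text \<open>
  The IBAP is surjectivity of \<open>z \<mapsto> (P k z)\<^sub>k\<close>, whose adjoint is \<open>(y k)\<^sub>k \<mapsto> (\<Sum>k. y k)\<close>; a surjective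
  operator has an adjoint that is bounded below. Testing the components against a fixed \<open>x\<close> and
  lifting \<open>x\<close> along the surjection gives weak boundedness, and uniform boundedness does the rest.
\<close>

lemma ibap_component_bound:
  fixes H :: "nat \<Rightarrow> 'a::{real_inner, complete_space} set"
  assumes ibap: "ibap n H" and k: "k \<in> {1..n}"
  shows "\<exists>C\<ge>0. \<forall>y. (\<forall>j\<in>{1..n}. y j \<in> H j) \<longrightarrow> norm (y k) \<le> C * norm (\<Sum>j\<in>{1..n}. y j)"
proof -
  have sub: "subspace (H j)" "closed (H j)" if "j \<in> {1..n}" for j
    using ibap that by (auto simp: ibap_def)
  define s where "s y = (\<Sum>j\<in>{1..n}. y j)" for y :: "nat \<Rightarrow> 'a"
  define Y where "Y = {y. \<forall>j\<in>{1..n}. y j \<in> H j}"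
  have weak: "\<exists>M\<ge>0. \<forall>y\<in>Y. \<bar>inner x (y k)\<bar> \<le> M * norm (s y)" for x
  proof -
    define p where "p = orth_proj (H k) x"
    define e where "e j = (if j = k then p else 0)" for j
    have "\<forall>j\<in>{1..n}. e j \<in> H j"
      using sub k by (auto simp: e_def p_def orth_proj_in subspace_0)
    then have "\<exists>z. \<forall>j\<in>{1..n}. orth_proj (H j) z = e j"
      using ibap unfolding ibap_def by blast
    then obtain z where z: "\<And>j. j \<in> {1..n} \<Longrightarrow> orth_proj (H j) z = e j"
      by blast
    have "\<bar>inner x (y k)\<bar> \<le> norm z * norm (s y)" if y: "y \<in> Y" for y
    proof -
      have yj: "inner z (y j) = (if j = k then inner p (y k) else 0)" if "j \<in> {1..n}" for j
        using orth_proj_orthogonal[OF sub(1,2)[OF that], of "y j" z] z[OF that] y that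
        by (auto simp: e_def Y_def orthogonal_def inner_diff_left)
      have "inner z (s y) = (\<Sum>j\<in>{1..n}. if j = k then inner p (y k) else 0)"
        unfolding s_def inner_sum_right by (intro sum.cong refl yj)
      also have "\<dots> = inner p (y k)"
        using k by simp
      also have "\<dots> = inner x (y k)"
        using orth_proj_orthogonal[OF sub[OF k], of "y k" x] y k
        by (simp add: Y_def p_def orthogonal_def inner_diff_left)
      finally show ?thesis
        using Cauchy_Schwarz_ineq2[of z "s y"] by simp
    qed
    then show ?thesis
      using norm_ge_zero by blast
  qed
  \<comment> \<open>Division by zero makes \<open>f y = 0\<close> when the sum vanishes, which keeps the family pointwise
    bounded; that \<open>y k = 0\<close> in this case follows from \<open>weak\<close>.\<close>
  define f where "f y x = inner ((1 / norm (s y)) *\<^sub>R y k) x" for y x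
  have "\<exists>C. \<forall>y\<in>Y. \<forall>x. norm (f y x) \<le> C * norm x"
  proof (rule uniform_boundedness_principle)
    show "bounded_linear (f y)" for y
      unfolding f_def by (rule bounded_linear_inner_right)
    fix x
    obtain M where "M \<ge> 0" and M: "\<And>y. y \<in> Y \<Longrightarrow> \<bar>inner x (y k)\<bar> \<le> M * norm (s y)"
      using weak[of x] by blast
    have "norm (f y x) \<le> M" if "y \<in> Y" for y
      using M[OF that] \<open>M \<ge> 0\<close>
      by (cases "s y = 0") (auto simp: f_def inner_commute abs_mult field_simps)
    then show "\<exists>M. \<forall>y\<in>Y. norm (f y x) \<le> M"
      by blast
  qed
  then obtain C where C: "\<And>y x. y \<in> Y \<Longrightarrow> norm (f y x) \<le> C * norm x"
    by blast
  have "norm (y k) \<le> max C 0 * norm (s y)" if y: "y \<in> Y" for y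
  proof (cases "s y = 0 \<or> y k = 0")
    case True
    moreover have "y k = 0" if "s y = 0"
    proof -
      obtain M where "\<bar>inner (y k) (y k)\<bar> \<le> M * norm (s y)"
        using weak y by blast
      then have "inner (y k) (y k) \<le> 0"
        using that by simp
      then show ?thesis
        by (metis inner_gt_zero_iff not_less)
    qed
    ultimately show ?thesis
      by auto
  next
    case False
    then have "norm (y k) * norm (y k) \<le> C * norm (y k) * norm (s y)"
      using C[OF y, of "y k"] by (simp add: f_def abs_mult dot_square_norm power2_eq_square field_simps)
    then have "norm (y k) \<le> C * norm (s y)"
      using False by (simp add: mult.assoc mult.left_commute[of C])
    also have "\<dots> \<le> max C 0 * norm (s y)"
      by (intro mult_right_mono) auto
    finally show ?thesis .
  qed
  then show ?thesis
    by (intro exI[of _ "max C 0"]) (auto simp: Y_def s_def)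
qed

text \<open>
  If a sequence of sums converges, its components are Cauchy by \<open>ibap_component_bound\<close>, and their
  limits stay in the closed subspaces \<open>H k\<close>.
\<close>

lemma ibap_closed_sum:
  fixes H :: "nat \<Rightarrow> 'a::{real_inner, complete_space} set"
  assumes ibap: "ibap n H"
  defines "S \<equiv> {\<Sum>j\<in>{1..n}. y j | y. \<forall>j\<in>{1..n}. y j \<in> H j}"
  shows "subspace S" "closed S"
proof -
  have sub: "subspace (H j)" "closed (H j)" if "j \<in> {1..n}" for j
    using ibap that by (auto simp: ibap_def)
  show S: "subspace S"
    unfolding subspace_def
  proof (intro conjI ballI allI)
    show "0 \<in> S"
      unfolding S_def using sub by (intro CollectI exI[of _ "\<lambda>_. 0"]) (simp add: subspace_0)
  next
    fix a b assume "a \<in> S" "b \<in> S"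
    then obtain u v where "a = (\<Sum>j\<in>{1..n}. u j)" "b = (\<Sum>j\<in>{1..n}. v j)"
      "\<forall>j\<in>{1..n}. u j \<in> H j" "\<forall>j\<in>{1..n}. v j \<in> H j"
      unfolding S_def by blast
    then show "a + b \<in> S"
      unfolding S_def using sub
      by (intro CollectI exI[of _ "\<lambda>j. u j + v j"]) (simp add: sum.distrib subspace_add)
  next
    fix c a assume "a \<in> S"
    then obtain u where "a = (\<Sum>j\<in>{1..n}. u j)" "\<forall>j\<in>{1..n}. u j \<in> H j"
      unfolding S_def by blast
    then show "c *\<^sub>R a \<in> S"
      unfolding S_def using sub
      by (intro CollectI exI[of _ "\<lambda>j. c *\<^sub>R u j"]) (simp add: scaleR_right.sum subspace_scale)
  qed
  show "closed S"
    unfolding closed_sequential_limits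
  proof (intro allI impI, elim conjE)
    fix a l assume "\<forall>m. a m \<in> S" and lim: "a \<longlonglongrightarrow> l"
    then have "\<forall>m. \<exists>y. a m = (\<Sum>j\<in>{1..n}. y j) \<and> (\<forall>j\<in>{1..n}. y j \<in> H j)"
      unfolding S_def by blast
    then obtain y where a: "\<And>m. a m = (\<Sum>j\<in>{1..n}. y m j)"
      and y: "\<And>m j. j \<in> {1..n} \<Longrightarrow> y m j \<in> H j"
      by metis
    have "\<exists>h. (\<lambda>m. y m k) \<longlonglongrightarrow> h" if k: "k \<in> {1..n}" for k
    proof -
      obtain C where C: "C \<ge> 0"
        "\<And>v. (\<forall>j\<in>{1..n}. v j \<in> H j) \<Longrightarrow> norm (v k) \<le> C * norm (\<Sum>j\<in>{1..n}. v j)"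
        using ibap_component_bound[OF ibap k] by blast
      have bound: "norm (y p k - y q k) \<le> C * norm (a p - a q)" for p q
        using C(2)[of "\<lambda>j. y p j - y q j"] y sub by (simp add: a sum_subtractf subspace_diff)
      have "Cauchy (\<lambda>m. y m k)"
        unfolding Cauchy_iff
      proof (intro allI impI)
        fix e :: real assume "e > 0"
        then have "e / (C + 1) > 0"
          using C(1) by simp
        then obtain M where M: "\<And>p q. p \<ge> M \<Longrightarrow> q \<ge> M \<Longrightarrow> norm (a p - a q) < e / (C + 1)"
          using LIMSEQ_imp_Cauchy[OF lim] unfolding Cauchy_iff by blast
        have "norm (y p k - y q k) < e" if "p \<ge> M" "q \<ge> M" for p q
        proof -
          have "norm (y p k - y q k) \<le> (C + 1) * norm (a p - a q)"
            using bound[of p q] norm_ge_zero[of "a p - a q"] by (simp only: distrib_right)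
          also have "\<dots> < e"
            using M[OF that] C(1) by (simp add: field_simps)
          finally show ?thesis .
        qed
        then show "\<exists>M. \<forall>p\<ge>M. \<forall>q\<ge>M. norm (y p k - y q k) < e"
          by blast
      qed
      then show ?thesis
        using Cauchy_convergent_iff convergent_def by blast
    qed
    then obtain h where h: "\<And>k. k \<in> {1..n} \<Longrightarrow> (\<lambda>m. y m k) \<longlonglongrightarrow> h k"
      by metis
    have "(\<lambda>m. \<Sum>j\<in>{1..n}. y m j) \<longlonglongrightarrow> (\<Sum>j\<in>{1..n}. h j)"
      by (intro tendsto_sum h)
    then have "a \<longlonglongrightarrow> (\<Sum>j\<in>{1..n}. h j)"
      by (simp only: a[symmetric])
    then have "l = (\<Sum>j\<in>{1..n}. h j)"
      by (rule LIMSEQ_unique[OF lim])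
    moreover have "h j \<in> H j" if "j \<in> {1..n}" for j
      using closed_sequentially[OF sub(2)[OF that] _ h[OF that]] y[OF that] by blast
    ultimately show "l \<in> S"
      unfolding S_def by blast
  qed
qed

text \<open>
  Existence of the decomposition is projection to the closed sum of the \<open>H k\<close>. Uniqueness,
  linearity and boundedness all come from one estimate of the components by \<open>x\<close>, because
  decompositions can be added and scaled.
\<close>

lemma ibap_component_operators:
  fixes H :: "nat \<Rightarrow> 'a::{real_inner, complete_space} set"
  assumes ibap: "ibap n H"
  obtains Q where "\<And>k. k \<in> {1..n} \<Longrightarrow> bounded_linear (Q k)"
    and "\<And>x. orth_decomp n H x (\<lambda>k. Q k x)"
    and "\<And>x y k. orth_decomp n H x y \<Longrightarrow> k \<in> {1..n} \<Longrightarrow> y k = Q k x"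
proof -
  have sub: "subspace (H j)" "closed (H j)" if "j \<in> {1..n}" for j
    using ibap that by (auto simp: ibap_def)
  define S where "S = {\<Sum>j\<in>{1..n}. y j | y. \<forall>j\<in>{1..n}. y j \<in> H j}"
  have S: "subspace S" "closed S"
    unfolding S_def using ibap_closed_sum[OF ibap] by auto
  have HS: "v \<in> S" if k: "k \<in> {1..n}" and v: "v \<in> H k" for k v
    unfolding S_def using sub k v
    by (intro CollectI exI[of _ "\<lambda>j. if j = k then v else 0"]) (auto simp: subspace_0)
  have "\<exists>y. orth_decomp n H x y" for x
  proof -
    have "orth_proj S x \<in> S"
      using S by (rule orth_proj_in)
    then obtain y where "orth_proj S x = (\<Sum>j\<in>{1..n}. y j)" "\<forall>j\<in>{1..n}. y j \<in> H j"
      unfolding S_def by blast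
    then have "orth_decomp n H x y"
      unfolding orth_decomp_def using orth_proj_orthogonal[OF S, of _ x] HS by auto
    then show ?thesis
      by blast
  qed
  then obtain Y where Y: "\<And>x. orth_decomp n H x (Y x)"
    by metis
  define Q where "Q k x = Y x k" for k x
  have Q: "orth_decomp n H x (\<lambda>k. Q k x)" for x
    using Y[of x] by (simp add: Q_def)
  have diff: "orth_decomp n H (x - x') (\<lambda>j. y j - y' j)"
    if "orth_decomp n H x y" "orth_decomp n H x' y'" for x x' y y'
    using that sub unfolding orth_decomp_def orthogonal_def
    by (auto simp: subspace_diff sum_subtractf inner_diff_left)
  have add: "orth_decomp n H (x + x') (\<lambda>j. y j + y' j)"
    if "orth_decomp n H x y" "orth_decomp n H x' y'" for x x' y y'
    using that sub unfolding orth_decomp_def orthogonal_def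
    by (auto simp: subspace_add sum.distrib inner_diff_left inner_add_left)
  have scale: "orth_decomp n H (c *\<^sub>R x) (\<lambda>j. c *\<^sub>R y j)"
    if "orth_decomp n H x y" for c x y
    using that sub unfolding orth_decomp_def orthogonal_def
    by (auto simp: subspace_scale inner_diff_left simp flip: scaleR_right.sum)
  have bound: "\<exists>C. \<forall>x y. orth_decomp n H x y \<longrightarrow> norm (y k) \<le> norm x * C" if k: "k \<in> {1..n}" for k
  proof -
    obtain C where C: "C \<ge> 0"
      "\<And>v. (\<forall>j\<in>{1..n}. v j \<in> H j) \<Longrightarrow> norm (v k) \<le> C * norm (\<Sum>j\<in>{1..n}. v j)"
      using ibap_component_bound[OF ibap k] by blast
    have "norm (y k) \<le> norm x * C" if y: "orth_decomp n H x y" for x y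
    proof -
      define p where "p = (\<Sum>j\<in>{1..n}. y j)"
      have "inner (x - p) p = (\<Sum>j\<in>{1..n}. inner (x - p) (y j))"
        by (simp add: p_def inner_sum_right)
      also have "\<dots> = 0"
        using y by (intro sum.neutral) (auto simp: orth_decomp_def orthogonal_def p_def)
      finally have "orthogonal (x - p) p"
        by (simp add: orthogonal_def)
      then have "(norm ((x - p) + p))\<^sup>2 = (norm (x - p))\<^sup>2 + (norm p)\<^sup>2"
        by (rule norm_add_Pythagorean)
      then have "(norm p)\<^sup>2 \<le> (norm x)\<^sup>2"
        by simp
      then have "norm p \<le> norm x"
        by (rule power2_le_imp_le) simp
      then have "C * norm p \<le> C * norm x"
        using C(1) by (rule mult_left_mono)
      moreover have "norm (y k) \<le> C * norm p"
        unfolding p_def using y by (intro C(2)) (simp add: orth_decomp_def)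
      ultimately show ?thesis
        by (simp add: mult.commute)
    qed
    then show ?thesis
      by blast
  qed
  have uniq: "y k = y' k" if "orth_decomp n H x y" "orth_decomp n H x y'" "k \<in> {1..n}" for x y y' k
    using bound[OF that(3)] diff[OF that(1,2)] by force
  show ?thesis
  proof
    show "orth_decomp n H x (\<lambda>k. Q k x)" for x
      by (rule Q)
    show "y k = Q k x" if "orth_decomp n H x y" "k \<in> {1..n}" for x y k
      by (rule uniq[OF that(1) Q that(2)])
    fix k assume k: "k \<in> {1..n}"
    obtain C where C: "\<And>x y. orth_decomp n H x y \<Longrightarrow> norm (y k) \<le> norm x * C"
      using bound[OF k] by blast
    show "bounded_linear (Q k)"
    proof (rule bounded_linear_intro)
      show "Q k (x + y) = Q k x + Q k y" for x y
        by (rule uniq[OF Q add[OF Q Q] k])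
      show "Q k (r *\<^sub>R x) = r *\<^sub>R Q k x" for r x
        by (rule uniq[OF Q scale[OF Q] k])
      show "norm (Q k x) \<le> norm x * C" for x
        by (rule C[OF Q])
    qed
  qed
qed

section \<open>Eigenspaces over a general scalar field\<close>

text \<open>
  The Hilbert space is real, and \<open>'k\<close> is a field of bounded operators on it that contains the real
  scalars and is closed under adjoints. Adjoints ensure that the orthogonal complement of a
  \<open>'k\<close>-subspace is again one. The instances of interest are the real and the complex numbers;
  characteristic \<open>0\<close> makes \<open>'k\<close> infinite, so that a further eigenvalue is always available.
\<close>

locale hilbert_scaling = vector_space scale
  for scale :: "'k::field_char_0 \<Rightarrow> 'a::{real_inner, complete_space} \<Rightarrow> 'a" (infixr \<open>\<star>\<close> 75) +
  fixes adj :: "'k \<Rightarrow> 'k"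
  assumes bounded_linear_scale: "bounded_linear (scale c)"
    and inner_scale_left: "inner (c \<star> x) y = inner x (adj c \<star> y)"
    and scaleR_eq_scale: "\<exists>c. \<forall>x. r *\<^sub>R x = c \<star> x"
begin

lemma bounded_linear_if_continuous:
  assumes "Vector_Spaces.linear scale scale A" and "continuous_on UNIV A"
  shows "bounded_linear A"
proof (rule linear_continuous_imp_bounded_linear)
  interpret A: Vector_Spaces.linear scale scale A by fact
  show "linear A"
  proof (rule linearI)
    show "A (r *\<^sub>R x) = r *\<^sub>R A x" for r x
      using scaleR_eq_scale[of r] by (auto simp: A.scale)
  qed (rule A.add)
qed fact

lemma real_subspace:
  assumes "module.subspace scale S"
  shows "Real_Vector_Spaces.subspace S"
proof -
  have "r *\<^sub>R x \<in> S" if "x \<in> S" for r x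
    using scaleR_eq_scale[of r] subspace_scale[OF assms that] by auto
  then show ?thesis
    using assms by (simp add: Real_Vector_Spaces.subspace_def subspace_0 subspace_add)
qed

lemma subspace_eigenspace:
  assumes "Vector_Spaces.linear scale scale A"
  shows "module.subspace scale {x. A x - c \<star> x = 0}"
proof -
  interpret A: Vector_Spaces.linear scale scale A by fact
  show ?thesis
    by (auto simp: subspace_def A.zero A.add A.scale scale_right_distrib scale_left_commute)
qed

text \<open>
  The factors of the interpolation act on every eigenspace as a scalar, namely \<open>1\<close> on the \<open>k\<close>-th
  and \<open>0\<close> on the \<open>j\<close>-th one.
\<close>

lemma ibap_eigenspaces:
  assumes A: "Vector_Spaces.linear scale scale A" and cont: "continuous_on UNIV A"
    and l: "inj_on l {1..n}"
  shows "ibap n (\<lambda>k. {x. A x - l k \<star> x = 0})"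
proof -
  interpret A: Vector_Spaces.linear scale scale A by fact
  have bA: "bounded_linear A"
    using A cont by (rule bounded_linear_if_continuous)
  define H where "H k = {x. A x - l k \<star> x = 0}" for k
  define D where "D k j x = inverse (l k - l j) \<star> (A x - l j \<star> x)" for k j x
  have D_eigen: "D k j x = (inverse (l k - l j) * (l i - l j)) \<star> x" if "x \<in> H i" for k j i x
    using that by (simp add: D_def H_def flip: scale_left_diff_distrib)
  have subH: "module.subspace scale (H k)" for k
    unfolding H_def by (rule subspace_eigenspace[OF A])
  have "\<exists>Q. bounded_linear Q \<and> (\<forall>x\<in>H k. Q x = x) \<and> (\<forall>j\<in>{1..n} - {k}. \<forall>x\<in>H j. Q x = 0)"
    if k: "k \<in> {1..n}" for k
  proof (rule composite_separating_operator[where D = "D k"])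
    show "bounded_linear (D k j)" for j
      unfolding D_def
      by (intro bounded_linear_compose[OF bounded_linear_scale] bounded_linear_sub bA
          bounded_linear_scale)
    show "D k j x = x" if j: "j \<in> {1..n} - {k}" and x: "x \<in> H k" for j x
    proof -
      have "l k - l j \<noteq> 0"
        using l j k by (auto dest: inj_onD)
      then show ?thesis
        by (simp add: D_eigen[OF x])
    qed
    show "D k j x = 0" if "x \<in> H j" for j x
      by (simp add: D_eigen[OF that])
    show "D k j x \<in> H i" if "x \<in> H i" for i j x
      unfolding D_eigen[OF that] using subspace_scale[OF subH that] .
  qed simp
  then obtain Q where Q: "\<And>k. k \<in> {1..n} \<Longrightarrow> bounded_linear (Q k)"
    "\<And>k x. k \<in> {1..n} \<Longrightarrow> x \<in> H k \<Longrightarrow> Q k x = x"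
    "\<And>k j x. k \<in> {1..n} \<Longrightarrow> j \<in> {1..n} - {k} \<Longrightarrow> x \<in> H j \<Longrightarrow> Q k x = 0"
    by metis
  have "ibap n H"
  proof (rule ibap_if_biorthogonal_operators[OF _ Q(1,2)])
    fix k
    have "closed (H k)"
      unfolding H_def
      by (intro closed_Collect_eq continuous_on_diff cont
          bounded_linear.continuous_on[OF bounded_linear_scale] continuous_on_const continuous_on_id)
    then show "Real_Vector_Spaces.subspace (H k) \<and> closed (H k)"
      using real_subspace[OF subH] by blast
  qed (use Q(3) in auto)
  then show ?thesis
    by (simp add: H_def[abs_def])
qed

lemma orth_decomp_scale:
  assumes H: "\<And>k. k \<in> {1..n} \<Longrightarrow> module.subspace scale (H k)" and y: "orth_decomp n H x y"
  shows "orth_decomp n H (c \<star> x) (\<lambda>k. c \<star> y k)"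
proof -
  have "c \<star> x - (\<Sum>j\<in>{1..n}. c \<star> y j) = c \<star> (x - (\<Sum>j\<in>{1..n}. y j))"
    by (simp add: scale_right_diff_distrib scale_sum_right)
  then show ?thesis
    using y H by (simp add: orth_decomp_def orthogonal_def inner_scale_left subspace_scale)
qed

text \<open>
  The operator is \<open>l k\<close> on each \<open>H k\<close> and a fresh scalar \<open>m\<close> on the orthogonal complement of their
  sum. Its eigenspaces are no larger than the \<open>H k\<close>, because \<open>A x - l k x\<close> has components
  \<open>(l j - l k) Q j x\<close> and remainder \<open>(m - l k) W x\<close>, and by uniqueness of the decomposition of \<open>0\<close> these all
  vanish if their sum does.
\<close>

lemma ibap_imp_eigenspaces:
  assumes ibap: "ibap n H" and H: "\<And>k. k \<in> {1..n} \<Longrightarrow> module.subspace scale (H k)"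
    and l: "inj_on l {1..n}"
  shows "\<exists>A. Vector_Spaces.linear scale scale A \<and> continuous_on UNIV A \<and>
    (\<forall>k\<in>{1..n}. H k = {x. A x - l k \<star> x = 0})"
proof -
  obtain Q where Q: "\<And>k. k \<in> {1..n} \<Longrightarrow> bounded_linear (Q k)"
    and dec: "\<And>x. orth_decomp n H x (\<lambda>k. Q k x)"
    and uniq: "\<And>x y k. orth_decomp n H x y \<Longrightarrow> k \<in> {1..n} \<Longrightarrow> y k = Q k x"
    using ibap_component_operators[OF ibap] by blast
  \<comment> \<open>The component operators are built from the real structure; uniqueness makes them commute
    with all scalars.\<close>
  have Q_scale: "Q k (c \<star> x) = c \<star> Q k x" if "k \<in> {1..n}" for k c x
    using uniq[OF orth_decomp_scale[OF H dec] that] by simp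
  obtain m where m: "m \<notin> l ` {1..n}"
    using ex_new_if_finite[OF infinite_UNIV_char_0, of "l ` {1..n}"] by blast
  define W where "W x = x - (\<Sum>k\<in>{1..n}. Q k x)" for x
  define A where "A x = m \<star> W x + (\<Sum>k\<in>{1..n}. l k \<star> Q k x)" for x
  have "bounded_linear A"
    unfolding A_def W_def
    by (intro bounded_linear_add bounded_linear_sum bounded_linear_sub bounded_linear_ident Q
        bounded_linear_compose[OF bounded_linear_scale])
  then interpret A: bounded_linear A .
  have "Vector_Spaces.linear scale scale A"
  proof unfold_locales
    show "A (x + y) = A x + A y" for x y
      by (rule A.add)
    have "(\<Sum>k\<in>{1..n}. Q k (c \<star> x)) = c \<star> (\<Sum>k\<in>{1..n}. Q k x)"
      "(\<Sum>k\<in>{1..n}. l k \<star> Q k (c \<star> x)) = c \<star> (\<Sum>k\<in>{1..n}. l k \<star> Q k x)" for c x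
      unfolding scale_sum_right
      by (auto intro!: sum.cong simp: Q_scale scale_left_commute)
    then show "A (c \<star> x) = c \<star> A x" for c x
      unfolding A_def W_def
      by (simp add: scale_right_diff_distrib scale_right_distrib scale_left_commute mult.commute[of m c])
  qed
  moreover have "continuous_on UNIV A"
    by (intro A.continuous_on continuous_on_id)
  moreover have "H k = {x. A x - l k \<star> x = 0}" if k: "k \<in> {1..n}" for k
  proof (intro set_eqI iffI CollectI; (elim CollectE)?)
    fix x assume x: "x \<in> H k"
    have "orth_decomp n H x (\<lambda>j. if j = k then x else 0)"
      using x k H by (simp add: orth_decomp_def subspace_0 orthogonal_def)
    then have Qx: "Q j x = (if j = k then x else 0)" if "j \<in> {1..n}" for j
      using uniq[OF _ that] by fastforce
    then have "W x = x - (\<Sum>j\<in>{1..n}. if j = k then x else 0)"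
      unfolding W_def by (intro arg_cong2[where f = minus] sum.cong) auto
    moreover have "(\<Sum>j\<in>{1..n}. l j \<star> Q j x) = (\<Sum>j\<in>{1..n}. if j = k then l k \<star> x else 0)"
      using Qx by (intro sum.cong) auto
    ultimately show "A x - l k \<star> x = 0"
      using k by (simp add: A_def)
  next
    fix x assume x: "A x - l k \<star> x = 0"
    have x_eq: "x = W x + (\<Sum>j\<in>{1..n}. Q j x)"
      by (simp add: W_def)
    have "l k \<star> x = l k \<star> W x + (\<Sum>j\<in>{1..n}. l k \<star> Q j x)"
      by (subst x_eq) (simp only: scale_right_distrib scale_sum_right)
    then have "(m - l k) \<star> W x + (\<Sum>j\<in>{1..n}. (l j - l k) \<star> Q j x) = 0"
      using x by (simp add: A_def scale_left_diff_distrib sum_subtractf algebra_simps)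
    then have split: "0 - (\<Sum>j\<in>{1..n}. (l j - l k) \<star> Q j x) = (m - l k) \<star> W x"
      by (metis eq_neg_iff_add_eq_0 diff_0)
    have "orth_decomp n H 0 (\<lambda>j. (l j - l k) \<star> Q j x)"
      unfolding orth_decomp_def split
      using dec[of x] H
      by (auto simp: orth_decomp_def orthogonal_def inner_scale_left subspace_scale W_def)
    then have "(l j - l k) \<star> Q j x = Q j 0" if "j \<in> {1..n}" for j
      using uniq[OF _ that] by blast
    then have Q0: "(l j - l k) \<star> Q j x = 0" if "j \<in> {1..n}" for j
      using that Q_scale[OF that, of 0 0] by simp
    then have "(\<Sum>j\<in>{1..n}. (l j - l k) \<star> Q j x) = 0"
      by (intro sum.neutral) blast
    then have "(m - l k) \<star> W x = 0"
      using split by (simp only: diff_self)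
    moreover have "m \<noteq> l k"
      using m k by blast
    ultimately have "W x = 0"
      by simp
    moreover have "Q j x = 0" if "j \<in> {1..n}" "j \<noteq> k" for j
      using Q0[OF that(1)] l k that by (auto dest: inj_onD)
    then have "(\<Sum>j\<in>{1..n}. Q j x) = (\<Sum>j\<in>{1..n}. if j = k then Q k x else 0)"
      by (intro sum.cong) auto
    ultimately have "x = Q k x"
      using x_eq k by simp
    moreover have "Q k x \<in> H k"
      using dec[of x] k by (auto simp: orth_decomp_def)
    ultimately show "x \<in> H k"
      by (rule ssubst)
  qed
  ultimately show ?thesis
    by blast
qed

end

section \<open>Real and complex Hilbert spaces\<close>

lemma hilbert_scaling_real:
  "hilbert_scaling (scaleR :: real \<Rightarrow> 'a \<Rightarrow> 'a::{real_inner, complete_space}) (\<lambda>c. c)"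
  by (intro hilbert_scaling.intro hilbert_scaling_axioms.intro real_vector.vector_space_axioms)
    (auto simp: bounded_linear_scaleR_right)

lemma bounded_linear_scaleC: "bounded_linear (scaleC c :: 'a \<Rightarrow> 'a::complex_inner)"
proof (rule bounded_linear_intro)
  fix x y :: 'a and r
  show "c *\<^sub>C (x + y) = c *\<^sub>C x + c *\<^sub>C y"
    by (rule scaleC_add_right)
  show "c *\<^sub>C (r *\<^sub>R x) = r *\<^sub>R c *\<^sub>C x"
    by (simp add: scaleR_scaleC scaleC_scaleC mult.commute)
  have "cinner (c *\<^sub>C x) (c *\<^sub>C x) = c * cinner (c *\<^sub>C x) x"
    by (rule cinner_scaleC_right)
  also have "cinner (c *\<^sub>C x) x = cnj (c * cinner x x)"
    using cinner_commute[of "c *\<^sub>C x" x] by (simp add: cinner_scaleC_right)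
  finally have "complex_of_real ((norm (c *\<^sub>C x))\<^sup>2) = complex_of_real ((cmod c * norm x)\<^sup>2)"
    by (simp add: cinner_self power_mult_distrib mult.assoc[symmetric]
        flip: complex_norm_square)
  then have "norm (c *\<^sub>C x) = cmod c * norm x"
    unfolding of_real_eq_iff by simp
  then show "norm (c *\<^sub>C x) \<le> norm x * cmod c"
    by (simp add: mult.commute)
qed

lemma hilbert_scaling_complex:
  "hilbert_scaling (scaleC :: complex \<Rightarrow> 'a \<Rightarrow> 'a::{complex_inner, complete_space}) cnj"
proof (intro hilbert_scaling.intro hilbert_scaling_axioms.intro complex_vector.vector_space_axioms)
  fix c :: complex and x y :: 'a
  show "bounded_linear (scaleC c :: 'a \<Rightarrow> 'a)"
    by (rule bounded_linear_scaleC)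
  have "cinner (c *\<^sub>C x) y = cinner x (cnj c *\<^sub>C y)"
    using cinner_commute[of "c *\<^sub>C x" y] cinner_commute[of x y] by (simp add: cinner_scaleC_right)
  then show "inner (c *\<^sub>C x) y = inner x (cnj c *\<^sub>C y)"
    by (simp flip: Re_cinner)
  show "\<exists>c. \<forall>x::'a. r *\<^sub>R x = c *\<^sub>C x" for r
    using scaleR_scaleC by blast
qed

text \<open>
  Multiplying \<open>y\<close> by \<open>\<i>\<close> stays in \<open>S\<close> and turns the imaginary part of the inner product into a real
  part, so real orthogonality to \<open>S\<close> is complex orthogonality.
\<close>

lemma corth_proj_eq_orth_proj:
  assumes S: "complex_vector.subspace S"
  shows "corth_proj S x = orth_proj S x"
proof -
  have "(\<forall>y\<in>S. cinner w y = 0) \<longleftrightarrow> (\<forall>y\<in>S. orthogonal w y)" for w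
  proof
    assume "\<forall>y\<in>S. cinner w y = 0"
    then show "\<forall>y\<in>S. orthogonal w y"
      by (simp add: orthogonal_def flip: Re_cinner)
  next
    assume ort: "\<forall>y\<in>S. orthogonal w y"
    show "\<forall>y\<in>S. cinner w y = 0"
    proof
      fix y assume y: "y \<in> S"
      then have "\<i> *\<^sub>C y \<in> S"
        using S by (rule complex_vector.subspace_scale[rotated])
      then have "Re (\<i> * cinner w y) = 0" "Re (cinner w y) = 0"
        using ort y by (simp_all add: orthogonal_def Re_cinner flip: cinner_scaleC_right)
      then show "cinner w y = 0"
        by (simp add: complex_eq_iff)
    qed
  qed
  then show ?thesis
    by (simp add: corth_proj_def orth_proj_def)
qed

lemma cibap_iff_ibap:
  fixes H :: "nat \<Rightarrow> 'a::{complex_inner, complete_space} set"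
  shows "cibap n H \<longleftrightarrow> (\<forall>k\<in>{1..n}. complex_vector.subspace (H k)) \<and> ibap n H"
  unfolding cibap_def ibap_def
  using hilbert_scaling.real_subspace[OF hilbert_scaling_complex]
  by (auto simp: corth_proj_eq_orth_proj)

theorem theorem4p2:
  "((\<forall>(A :: 'a::{real_inner, complete_space} \<Rightarrow> 'a) (l :: nat \<Rightarrow> real) (n :: nat).
        linear A \<and> continuous_on UNIV A \<and> inj_on l {1..n} \<longrightarrow>
        ibap n (\<lambda>k. {x. A x - l k *\<^sub>R x = 0})) \<and>
    (\<forall>(H :: nat \<Rightarrow> 'a set) (l :: nat \<Rightarrow> real) (n :: nat).
        ibap n H \<and> inj_on l {1..n} \<longrightarrow>
        (\<exists>A :: 'a \<Rightarrow> 'a. linear A \<and> continuous_on UNIV A \<and>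
          (\<forall>k\<in>{1..n}. H k = {x. A x - l k *\<^sub>R x = 0})))) \<and>
   ((\<forall>(A :: 'b::{complex_inner, complete_space} \<Rightarrow> 'b) (l :: nat \<Rightarrow> complex) (n :: nat).
        clinear A \<and> continuous_on UNIV A \<and> inj_on l {1..n} \<longrightarrow>
        cibap n (\<lambda>k. {x. A x - l k *\<^sub>C x = 0})) \<and>
    (\<forall>(H :: nat \<Rightarrow> 'b set) (l :: nat \<Rightarrow> complex) (n :: nat).
        cibap n H \<and> inj_on l {1..n} \<longrightarrow>
        (\<exists>A :: 'b \<Rightarrow> 'b. clinear A \<and> continuous_on UNIV A \<and>
          (\<forall>k\<in>{1..n}. H k = {x. A x - l k *\<^sub>C x = 0}))))"
proof (intro conjI allI impI; elim conjE)
  fix A :: "'a \<Rightarrow> 'a" and l :: "nat \<Rightarrow> real" and n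
  assume "linear A" "continuous_on UNIV A" "inj_on l {1..n}"
  then show "ibap n (\<lambda>k. {x. A x - l k *\<^sub>R x = 0})"
    unfolding linear_def by (rule hilbert_scaling.ibap_eigenspaces[OF hilbert_scaling_real])
next
  fix H :: "nat \<Rightarrow> 'a set" and l :: "nat \<Rightarrow> real" and n
  assume "ibap n H" "inj_on l {1..n}"
  then show "\<exists>A :: 'a \<Rightarrow> 'a. linear A \<and> continuous_on UNIV A \<and>
      (\<forall>k\<in>{1..n}. H k = {x. A x - l k *\<^sub>R x = 0})"
    unfolding linear_def by (intro hilbert_scaling.ibap_imp_eigenspaces[OF hilbert_scaling_real])
      (auto simp: ibap_def subspace_raw_def)
next
  fix A :: "'b \<Rightarrow> 'b" and l :: "nat \<Rightarrow> complex" and n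
  assume "clinear A" "continuous_on UNIV A" "inj_on l {1..n}"
  then show "cibap n (\<lambda>k. {x. A x - l k *\<^sub>C x = 0})"
    unfolding cibap_iff_ibap
    using hilbert_scaling.ibap_eigenspaces[OF hilbert_scaling_complex]
      hilbert_scaling.subspace_eigenspace[OF hilbert_scaling_complex] by blast
next
  fix H :: "nat \<Rightarrow> 'b set" and l :: "nat \<Rightarrow> complex" and n
  assume "cibap n H" "inj_on l {1..n}"
  then show "\<exists>A :: 'b \<Rightarrow> 'b. clinear A \<and> continuous_on UNIV A \<and>
      (\<forall>k\<in>{1..n}. H k = {x. A x - l k *\<^sub>C x = 0})"
    unfolding cibap_iff_ibap
    by (intro hilbert_scaling.ibap_imp_eigenspaces[OF hilbert_scaling_complex]) auto
qed

end
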